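(* \textsc{Token Jumping}, parameterized by $k$, admits a kernel with at most $\mathcal{O}(k^{2})$ vertices on $\{C_3,C_4\}$-free graphs, as well as on bipartite $C_4$-free graphs.
   Context: \textsc{Token Jumping}: given a graph $G$ and two independent sets $S,T$ of $G$ with $|S|=|T|=k\ge 1$, decide whether there is a sequence $S=S_0,S_1,\dots,S_\ell=T$ of independent sets of size $k$ with $|S_i\,\Delta\, S_{i+1}|=2$ for all $i$ (each step removes one token from a vertex and places it on any other vertex, keeping independence). A graph is $H$-free if it contains no induced subgraph isomorphic to $H$; $C_p$ is the cycle on $p$ vertices. A kernel with at most $f(k)$ vertices is a polynomial-time algorithm that maps any instance $(G,S,T,k)$ from the class to an equivalent instance whose graph has at most $f(k)$ vertices. *)

theory Defs
  imports
    "Graph_Theory.Pair_Digraph"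
    "Graph_Theory.Digraph_Isomorphism"
    "HOL-Library.Landau_Symbols"
    "HOL-Computational_Algebra.Polynomial"
begin

section \<open>Graph classes\<close>

text \<open>A finite simple graph is a \<open>pair_graph\<close>: each edge \<open>uv\<close> is represented by the two
  arcs \<open>(u, v)\<close> and \<open>(v, u)\<close>.\<close>

text \<open>The graph \<open>C\<^sub>p\<close>, for \<open>p \<ge> 3\<close>.\<close>

definition cycle_graph :: "nat \<Rightarrow> nat pair_pre_digraph" where
  "cycle_graph p = \<lparr> pverts = {..<p},
     parcs = {(i, j). i < p \<and> j < p \<and> (j = Suc i mod p \<or> i = Suc j mod p)} \<rparr>"

definition induced_free :: "'b pair_pre_digraph \<Rightarrow> 'a pair_pre_digraph \<Rightarrow> bool" where
  "induced_free H G \<longleftrightarrow>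
     \<not> (\<exists>I. induced_subgraph I (with_proj G) \<and> digraph_iso I (with_proj H))"

definition bipartite :: "'a pair_pre_digraph \<Rightarrow> bool" where
  "bipartite G \<longleftrightarrow>
     (\<exists>A B. pverts G = A \<union> B \<and> A \<inter> B = {} \<and> parcs G \<subseteq> A \<times> B \<union> B \<times> A)"

section \<open>Token Jumping\<close>

definition independent_set :: "'a pair_pre_digraph \<Rightarrow> 'a set \<Rightarrow> bool" where
  "independent_set G X \<longleftrightarrow> X \<subseteq> pverts G \<and> (\<forall>u\<in>X. \<forall>v\<in>X. (u, v) \<notin> parcs G)"

text \<open>Instances are given to algorithms, so their vertices are numbered: the vertex set is
  \<open>{..<n}\<close>.\<close>

record tj_instance =
  tj_graph :: "nat pair_pre_digraph"
  tj_source :: "nat set"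
  tj_target :: "nat set"
  tj_tokens :: nat

definition num_verts :: "tj_instance \<Rightarrow> nat" where
  "num_verts x = card (pverts (tj_graph x))"

definition valid_tj_instance :: "tj_instance \<Rightarrow> bool" where
  "valid_tj_instance x \<longleftrightarrow>
     pair_graph (tj_graph x) \<and> pverts (tj_graph x) = {..<num_verts x} \<and>
     independent_set (tj_graph x) (tj_source x) \<and> independent_set (tj_graph x) (tj_target x) \<and>
     card (tj_source x) = tj_tokens x \<and> card (tj_target x) = tj_tokens x \<and> 1 \<le> tj_tokens x"

definition tj_yes :: "tj_instance \<Rightarrow> bool" where
  "tj_yes x \<longleftrightarrow>
     (\<exists>l (X :: nat \<Rightarrow> nat set). X 0 = tj_source x \<and> X l = tj_target x \<and>
        (\<forall>i\<le>l. independent_set (tj_graph x) (X i) \<and> card (X i) = tj_tokens x) \<and>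
        (\<forall>i<l. card (sym_diff (X i) (X (Suc i))) = 2))"

section \<open>Multitape Turing machines\<close>

text \<open>Tape symbols are the numbers below \<open>tm_symbols\<close>, where \<open>0\<close> is the blank, and states are
  the numbers below \<open>tm_states\<close>, where \<open>0\<close> is the initial state.  Inputs and outputs are words
  over the symbols 1, 2, 3.  The transition function reads one symbol per tape and returns the
  new state and, for each tape, the symbol to write and the movement of the head.  Only its
  values on states below \<open>tm_states\<close> and symbols below \<open>tm_symbols\<close> matter, so that a machine
  is a finite object.\<close>

datatype head_move = Move_Left | Stay | Move_Right

record turing_machine =
  tm_tapes :: nat
  tm_symbols :: nat
  tm_states :: nat
  tm_halt :: nat
  tm_delta :: "nat \<Rightarrow> nat list \<Rightarrow> nat \<times> (nat \<times> head_move) list"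

definition is_turing_machine :: "turing_machine \<Rightarrow> bool" where
  "is_turing_machine M \<longleftrightarrow>
     1 \<le> tm_tapes M \<and> 4 \<le> tm_symbols M \<and> 1 \<le> tm_states M \<and> tm_halt M < tm_states M \<and>
     (\<forall>q < tm_states M. \<forall>ss. length ss = tm_tapes M \<and> set ss \<subseteq> {..<tm_symbols M} \<longrightarrow>
        (case tm_delta M q ss of (q', acts) \<Rightarrow>
           q' < tm_states M \<and> length acts = tm_tapes M \<and> fst ` set acts \<subseteq> {..<tm_symbols M}))"

text \<open>A tape is two-way infinite and consists of its contents and the position of its head.\<close>

type_synonym tape = "(int \<Rightarrow> nat) \<times> int"

fun tape_read :: "tape \<Rightarrow> nat" where
  "tape_read (c, h) = c h"

fun tape_act :: "nat \<times> head_move \<Rightarrow> tape \<Rightarrow> tape" where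
  "tape_act (s, m) (c, h) =
     (c(h := s), case m of Move_Left \<Rightarrow> h - 1 | Stay \<Rightarrow> h | Move_Right \<Rightarrow> h + 1)"

fun tm_step :: "turing_machine \<Rightarrow> nat \<times> tape list \<Rightarrow> nat \<times> tape list" where
  "tm_step M (q, ts) =
     (if q = tm_halt M then (q, ts)
      else case tm_delta M q (map tape_read ts) of (q', acts) \<Rightarrow> (q', map2 tape_act acts ts))"

definition word_contents :: "nat list \<Rightarrow> int \<Rightarrow> nat" where
  "word_contents w i = (if 0 \<le> i \<and> i < int (length w) then w ! nat i else 0)"

text \<open>The input is on the first tape, starting under the head; the other tapes are blank.\<close>

definition tm_init :: "turing_machine \<Rightarrow> nat list \<Rightarrow> nat \<times> tape list" where
  "tm_init M w = (0, (word_contents w, 0) # replicate (tm_tapes M - 1) (word_contents [], 0))"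

text \<open>On input \<open>w\<close>, the machine halts within \<open>t\<close> steps with exactly \<open>w'\<close> on its last tape.
  The last tape is also the input tape if there is only one.\<close>

definition tm_outputs_within ::
  "turing_machine \<Rightarrow> nat \<Rightarrow> nat list \<Rightarrow> nat list \<Rightarrow> bool" where
  "tm_outputs_within M t w w' \<longleftrightarrow>
     (case (tm_step M ^^ t) (tm_init M w) of (q, ts) \<Rightarrow>
        q = tm_halt M \<and> fst (last ts) = word_contents w')"

section \<open>Kernels\<close>

text \<open>An instance is encoded by the number of tokens in unary, the characteristic vectors of
  the two independent sets and the adjacency matrix in row-major order, separated by the
  symbol 3.\<close>

definition bit_symbol :: "bool \<Rightarrow> nat" where
  "bit_symbol b = (if b then 2 else 1)"

definition encode_tj :: "tj_instance \<Rightarrow> nat list" where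
  "encode_tj x =
     (let vs = [0..<num_verts x] in
        replicate (tj_tokens x) 2 @ [3] @
        map (\<lambda>v. bit_symbol (v \<in> tj_source x)) vs @ [3] @
        map (\<lambda>v. bit_symbol (v \<in> tj_target x)) vs @ [3] @
        concat (map (\<lambda>u. map (\<lambda>v. bit_symbol ((u, v) \<in> parcs (tj_graph x))) vs) vs))"

text \<open>The problem restricted to the class \<open>\<C>\<close> has a kernel with at most \<open>f k\<close> vertices.
  Inputs and outputs are instances of the restricted problem, and the running time is
  polynomial in the length of the encoded input.\<close>

definition tj_kernel :: "(nat pair_pre_digraph \<Rightarrow> bool) \<Rightarrow> (nat \<Rightarrow> nat) \<Rightarrow> bool" where
  "tj_kernel \<C> f \<longleftrightarrow>
     (\<exists>M (p :: nat poly). is_turing_machine M \<and>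
        (\<forall>x. valid_tj_instance x \<and> \<C> (tj_graph x) \<longrightarrow>
           (\<exists>y. valid_tj_instance y \<and> \<C> (tj_graph y) \<and>
              tm_outputs_within M (poly p (length (encode_tj x))) (encode_tj x) (encode_tj y) \<and>
              (tj_yes x \<longleftrightarrow> tj_yes y) \<and>
              num_verts y \<le> f (tj_tokens x))))"

end

theory Submission
  imports Defs
begin

text \<open>Let \<open>G\<close> be a graph without triangles and without cycles of length four; bipartite
  \<open>C\<^sub>4\<close>-free graphs are of this kind.  If \<open>G\<close> has at least \<open>9k\<^sup>2\<close> vertices, then every instance
  with \<open>k\<close> tokens is a yes-instance.  Indeed, if a vertex \<open>v\<close> has at least \<open>3k\<close> neighbours,
  these are independent, and every vertex of \<open>S \<union> T\<close> other than \<open>v\<close> excludes at most one of them,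
  so that both \<open>S\<close> and \<open>T\<close> can be moved to \<open>k\<close> of them.  Otherwise at most \<open>6k\<^sup>2\<close> vertices belong
  to the closed neighbourhood of \<open>S \<union> T\<close>, and the remaining ones contain an independent set of
  size \<open>k\<close> that both \<open>S\<close> and \<open>T\<close> can be moved to.  Hence a kernelization only has to compare \<open>n\<close>
  with \<open>9k\<^sup>2\<close>, and to output either the input or a fixed yes-instance.\<close>

section \<open>Graphs of girth at least five\<close>

lemma not_induced_freeI:
  assumes "pair_graph G" and e: "inj_on e (pverts H)" "e ` pverts H \<subseteq> pverts G"
    and H: "parcs H \<subseteq> pverts H \<times> pverts H"
    and arcs: "\<And>i j. i \<in> pverts H \<Longrightarrow> j \<in> pverts H \<Longrightarrow> (e i, e j) \<in> parcs G \<longleftrightarrow> (i, j) \<in> parcs H"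
  shows "\<not> induced_free H G"
proof -
  interpret pair_graph G by fact
  \<comment> \<open>\<open>digraph_iso\<close> asks for a map from the induced subgraph onto
    \<open>H\<close>, so the embedding \<open>e\<close> has to be inverted.\<close>
  define g where "g = the_inv_into (pverts H) e"
  have g: "g (e i) = i" if "i \<in> pverts H" for i
    unfolding g_def using e(1) that by (rule the_inv_into_f_f)
  define I where "I = with_proj G \<restriction> (e ` pverts H)"
  have I: "induced_subgraph I (with_proj G)"
    unfolding I_def using e(2) by (intro induced_induce) auto
  define f where "f = \<lparr>iso_verts = g, iso_arcs = map_prod g g, iso_head = snd, iso_tail = fst\<rparr>"
  have arcsI: "arcs I = map_prod e e ` parcs H"
    using H arcs by (force simp: I_def image_iff)
  have vertsI: "verts I = e ` pverts H"
    by (simp add: I_def)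
  have inj: "inj_on g (e ` pverts H)"
    by (auto simp: inj_on_def g)
  have "inj_on (map_prod g g) (map_prod e e ` parcs H)"
    using H by (auto simp: inj_on_def g subset_iff)
  moreover have "wf_digraph I"
    using I by auto
  ultimately have "pre_digraph.digraph_isomorphism I f"
    unfolding pre_digraph.digraph_isomorphism_def f_def arcsI vertsI using inj
    by (auto simp: I_def)
  moreover have "map_prod g g ` map_prod e e ` parcs H = parcs H"
    using H by (force simp: image_iff g)
  then have "with_proj H = app_iso f I"
    unfolding app_iso_def f_def arcsI vertsI with_proj_def by (force simp: g)
  ultimately show ?thesis
    using I unfolding induced_free_def digraph_iso_def by blast
qed

lemma induced_free_triangle:
  assumes "pair_graph G" "induced_free (cycle_graph 3) G"
    and "(u, v) \<in> parcs G" "(v, w) \<in> parcs G"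
  shows "(u, w) \<notin> parcs G"
proof
  assume uw: "(u, w) \<in> parcs G"
  interpret pair_graph G by fact
  have e: "(u, v) \<in> parcs G" "(v, w) \<in> parcs G" "(u, w) \<in> parcs G"
    "(v, u) \<in> parcs G" "(w, v) \<in> parcs G" "(w, u) \<in> parcs G" "(x, x) \<notin> parcs G" for x
    using assms(3,4) uw arcs_symmetric no_loops' by blast+
  have ne: "u \<noteq> v" "v \<noteq> w" "u \<noteq> w"
    using e by auto
  have V: "pverts (cycle_graph 3) = {0, 1, 2}"
    by (auto simp: cycle_graph_def)
  have "\<not> induced_free (cycle_graph 3) G"
  proof (rule not_induced_freeI[where e = "\<lambda>i. [u, v, w] ! i"])
    show "inj_on (\<lambda>i. [u, v, w] ! i) (pverts (cycle_graph 3))"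
      using ne by (simp add: V inj_on_def)
    show "(\<lambda>i. [u, v, w] ! i) ` pverts (cycle_graph 3) \<subseteq> pverts G"
      using e wellformed' by (simp add: V)
    show "parcs (cycle_graph 3) \<subseteq> pverts (cycle_graph 3) \<times> pverts (cycle_graph 3)"
      by (auto simp: cycle_graph_def)
    show "([u, v, w] ! i, [u, v, w] ! j) \<in> parcs G \<longleftrightarrow> (i, j) \<in> parcs (cycle_graph 3)"
      if "i \<in> pverts (cycle_graph 3)" "j \<in> pverts (cycle_graph 3)" for i j
      using that unfolding V by (elim insertE emptyE) (simp_all add: cycle_graph_def e)
  qed fact
  with assms(2) show False by blast
qed

text \<open>Otherwise \<open>u\<close>, \<open>x\<close>, \<open>v\<close>, \<open>y\<close> form a
  four-cycle. A diagonal would close a triangle, so the cycle is induced.\<close>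

lemma induced_free_square:
  assumes "pair_graph G" "induced_free (cycle_graph 4) G"
    and tri: "\<And>u v w. (u, v) \<in> parcs G \<Longrightarrow> (v, w) \<in> parcs G \<Longrightarrow> (u, w) \<notin> parcs G"
    and "(u, x) \<in> parcs G" "(u, y) \<in> parcs G" "(v, x) \<in> parcs G" "(v, y) \<in> parcs G"
  shows "u = v \<or> x = y"
proof (rule ccontr)
  assume neg: "\<not> (u = v \<or> x = y)"
  interpret pair_graph G by fact
  have e: "(u, x) \<in> parcs G" "(u, y) \<in> parcs G" "(v, x) \<in> parcs G" "(v, y) \<in> parcs G"
    "(x, u) \<in> parcs G" "(y, u) \<in> parcs G" "(x, v) \<in> parcs G" "(y, v) \<in> parcs G"
    "(z, z) \<notin> parcs G" for z
    using assms(4-) arcs_symmetric no_loops' by blast+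
  have ne: "u \<noteq> x" "u \<noteq> y" "v \<noteq> x" "v \<noteq> y" "u \<noteq> v" "x \<noteq> y"
    using e neg by auto
  have non: "(u, v) \<notin> parcs G" "(v, u) \<notin> parcs G" "(x, y) \<notin> parcs G" "(y, x) \<notin> parcs G"
    using e tri by blast+
  have V: "pverts (cycle_graph 4) = {0, 1, 2, 3}"
    by (auto simp: cycle_graph_def)
  have "\<not> induced_free (cycle_graph 4) G"
  proof (rule not_induced_freeI[where e = "\<lambda>i. [u, x, v, y] ! i"])
    show "inj_on (\<lambda>i. [u, x, v, y] ! i) (pverts (cycle_graph 4))"
      using ne by (simp add: V inj_on_def)
    show "(\<lambda>i. [u, x, v, y] ! i) ` pverts (cycle_graph 4) \<subseteq> pverts G"
      using e wellformed' by (simp add: V)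
    show "parcs (cycle_graph 4) \<subseteq> pverts (cycle_graph 4) \<times> pverts (cycle_graph 4)"
      by (auto simp: cycle_graph_def)
    show "([u, x, v, y] ! i, [u, x, v, y] ! j) \<in> parcs G \<longleftrightarrow> (i, j) \<in> parcs (cycle_graph 4)"
      if "i \<in> pverts (cycle_graph 4)" "j \<in> pverts (cycle_graph 4)" for i j
      using that unfolding V by (elim insertE emptyE) (simp_all add: cycle_graph_def e non)
  qed fact
  with assms(2) show False by blast
qed

lemma bipartite_triangle:
  assumes "bipartite G" "(u, v) \<in> parcs G" "(v, w) \<in> parcs G"
  shows "(u, w) \<notin> parcs G"
  using assms unfolding bipartite_def by blast

text \<open>Both graph classes end up here: bipartite graphs have no triangles, and without
  triangles every four-cycle is induced, so the conditions can ignore whether a cycle is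
  induced.\<close>

locale girth5_graph = pair_graph G for G :: "'a pair_pre_digraph" +
  assumes triangle_free: "(u, v) \<in> parcs G \<Longrightarrow> (v, w) \<in> parcs G \<Longrightarrow> (u, w) \<notin> parcs G"
    and square_free: "(u, x) \<in> parcs G \<Longrightarrow> (u, y) \<in> parcs G \<Longrightarrow> (v, x) \<in> parcs G \<Longrightarrow>
      (v, y) \<in> parcs G \<Longrightarrow> u = v \<or> x = y"

lemma girth5_graphI:
  assumes "pair_graph G" "induced_free (cycle_graph 4) G"
    and "induced_free (cycle_graph 3) G \<or> bipartite G"
  shows "girth5_graph G"
proof -
  have tri: "(u, w) \<notin> parcs G" if "(u, v) \<in> parcs G" "(v, w) \<in> parcs G" for u v w
    using that assms induced_free_triangle bipartite_triangle by metis
  show ?thesis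
    unfolding girth5_graph_def girth5_graph_axioms_def
    using assms(1) tri induced_free_square[OF assms(1,2)] by blast
qed

section \<open>Sequences of token jumps\<close>

definition jump :: "'a pair_pre_digraph \<Rightarrow> nat \<Rightarrow> 'a set \<Rightarrow> 'a set \<Rightarrow> bool" where
  "jump G k X Y \<longleftrightarrow> independent_set G X \<and> independent_set G Y \<and> card X = k \<and> card Y = k \<and>
     card (sym_diff X Y) = 2"

lemma jump_commute: "jump G k X Y \<longleftrightarrow> jump G k Y X"
  by (auto simp: jump_def Un_commute)

lemma jumps_commute: "(jump G k)\<^sup>*\<^sup>* X Y \<Longrightarrow> (jump G k)\<^sup>*\<^sup>* Y X"
  by (induction rule: rtranclp_induct)
    (auto dest: iffD1[OF jump_commute] intro: converse_rtranclp_into_rtranclp)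

lemma independent_set_mono: "independent_set G X \<Longrightarrow> Y \<subseteq> X \<Longrightarrow> independent_set G Y"
  by (auto simp: independent_set_def)

lemma jump_swap:
  assumes "independent_set G X" "independent_set G (insert y (X - {x}))" "finite X"
    and "x \<in> X" "y \<notin> X" "card X = k"
  shows "jump G k X (insert y (X - {x}))"
proof -
  have "sym_diff X (insert y (X - {x})) = {x, y}"
    using assms(4,5) by auto
  moreover have "x \<noteq> y"
    using assms(4,5) by auto
  then have "card {x, y} = 2"
    by simp
  moreover have "card (insert y (X - {x})) = k"
    using assms by (metis card_Suc_Diff1 card_insert_disjoint finite_Diff Diff_iff)
  ultimately show ?thesis
    using assms by (simp add: jump_def)
qed

text \<open>Every subset of \<open>X \<union> J\<close> is independent, so the tokens on
  \<open>X - J\<close> can be exchanged one by one, in any order, for vertices of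
  \<open>J - X\<close>.\<close>

lemma jumps_within_independent_set:
  assumes "independent_set G (X \<union> J)" "finite X" "finite J" "card X = k" "card J = k"
  shows "(jump G k)\<^sup>*\<^sup>* X J"
  using assms
proof (induction "card (X - J)" arbitrary: X)
  case 0
  then have "X \<subseteq> J" by simp
  then have "X = J"
    using 0 by (intro card_subset_eq) auto
  then show ?case by simp
next
  case (Suc n)
  then obtain x where x: "x \<in> X - J"
    by (metis card.empty equals0I nat.distinct(1))
  have "card (J - X) = card (X - J)"
    using Suc.prems card_Diff_subset_Int[of J X] card_Diff_subset_Int[of X J]
    by (simp add: Int_commute)
  then obtain y where y: "y \<in> J - X"
    using Suc.hyps(2) by (metis card.empty equals0I nat.distinct(1))
  define X' where "X' = insert y (X - {x})"
  have "X' \<union> J \<subseteq> X \<union> J"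
    using x y by (auto simp: X'_def)
  then have ind: "independent_set G (X' \<union> J)"
    using Suc.prems(1) independent_set_mono by blast
  have "jump G k X X'"
    unfolding X'_def using x y Suc.prems ind
    by (intro jump_swap) (auto intro: independent_set_mono simp: X'_def)
  moreover have "(jump G k)\<^sup>*\<^sup>* X' J"
  proof (rule Suc.hyps(1))
    have "X' - J = (X - J) - {x}"
      using y by (auto simp: X'_def)
    then show "n = card (X' - J)"
      using Suc.hyps(2) x Suc.prems(2) by simp
    show "card X' = k"
      using \<open>jump G k X X'\<close> by (simp add: jump_def)
  qed (use Suc.prems ind in \<open>auto simp: X'_def\<close>)
  ultimately show ?case
    by (rule converse_rtranclp_into_rtranclp)
qed

lemma tj_yesI:
  assumes "valid_tj_instance x"
    and "(jump (tj_graph x) (tj_tokens x))\<^sup>*\<^sup>* (tj_source x) (tj_target x)"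
  shows "tj_yes x"
proof -
  from assms(2) obtain l where "((jump (tj_graph x) (tj_tokens x)) ^^ l) (tj_source x) (tj_target x)"
    by (auto simp: rtranclp_power)
  then obtain X where X: "X 0 = tj_source x" "X l = tj_target x"
    "\<And>i. i < l \<Longrightarrow> jump (tj_graph x) (tj_tokens x) (X i) (X (Suc i))"
    by (auto simp: relpowp_fun_conv)
  \<comment> \<open>No jump starts at \<open>X l\<close>, and for \<open>l = 0\<close> there is no
    jump at all; the last set is therefore handled by the validity of the instance.\<close>
  have "independent_set (tj_graph x) (X i) \<and> card (X i) = tj_tokens x" if "i \<le> l" for i
    using that X assms(1) by (cases "i = l") (auto simp: jump_def valid_tj_instance_def)
  then show ?thesis
    unfolding tj_yes_def using X by (auto simp: jump_def)
qed

section \<open>Neighbourhoods and greedy independent sets\<close>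

context pair_graph
begin

abbreviation nbrs :: "'a \<Rightarrow> 'a set" where
  "nbrs v \<equiv> {u. (v, u) \<in> parcs G}"

lemma nbrs_subset: "nbrs v \<subseteq> pverts G"
  using in_arcsD2 by auto

lemma finite_nbrs: "finite (nbrs v)"
  using nbrs_subset pair_finite_verts by (rule finite_subset)

lemma no_arc_refl: "(v, v) \<notin> parcs G"
  using no_loops' by blast

lemma arcs_commute: "(u, v) \<in> parcs G \<longleftrightarrow> (v, u) \<in> parcs G"
  using arcs_symmetric by blast

text \<open>Each chosen vertex discards its closed neighbourhood, which has at most \<open>d\<close>
  vertices.\<close>

lemma greedy_independent_set:
  assumes deg: "\<And>v. v \<in> pverts G \<Longrightarrow> card (nbrs v) < d"
    and "0 < d" "U \<subseteq> pverts G" "d * k \<le> card U"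
  obtains J where "J \<subseteq> U" "independent_set G J" "card J = k"
  using assms(3,4)
proof (induction k arbitrary: U thesis)
  case 0
  show ?case by (rule "0.prems"(1)[of "{}"]) (auto simp: independent_set_def)
next
  case (Suc k)
  have fin: "finite U"
    using Suc.prems(2) pair_finite_verts by (rule finite_subset)
  have "U \<noteq> {}"
    using Suc.prems(3) \<open>0 < d\<close> by auto
  then obtain u where u: "u \<in> U" by blast
  define U' where "U' = U - insert u (nbrs u)"
  have "card (insert u (nbrs u)) \<le> d"
    using deg[of u] u Suc.prems(2) by (auto simp: card_insert_if finite_nbrs no_arc_refl)
  moreover have "card U - card (insert u (nbrs u)) \<le> card U'"
    unfolding U'_def by (intro diff_card_le_card_Diff) (simp add: finite_nbrs)
  ultimately have "d * k \<le> card U'"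
    using Suc.prems(3) by simp
  moreover have "U' \<subseteq> pverts G"
    using Suc.prems(2) by (auto simp: U'_def)
  ultimately obtain J where J: "J \<subseteq> U'" "independent_set G J" "card J = k"
    using Suc.IH by blast
  have "finite J"
    using J(1) fin by (auto simp: U'_def intro: finite_subset)
  show ?case
  proof (rule Suc.prems(1))
    show "insert u J \<subseteq> U"
      using J(1) u by (auto simp: U'_def)
    show "independent_set G (insert u J)"
      using J(1,2) u Suc.prems(2) arcs_commute no_arc_refl
      by (fastforce simp: U'_def independent_set_def)
    show "card (insert u J) = Suc k"
      using J \<open>finite J\<close> by (subst card_insert_disjoint) (auto simp: U'_def)
  qed
qed

end

section \<open>Reconfiguration in large graphs of girth at least five\<close>

context girth5_graph
begin

lemma independent_nbrs: "independent_set G (nbrs v)"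
  using triangle_free nbrs_subset by (auto simp: independent_set_def)

text \<open>Two common neighbours of \<open>s\<close> and \<open>v\<close> would form a square; if
  \<open>s\<close> itself is a neighbour of \<open>v\<close>, a common neighbour would close a
  triangle.\<close>

lemma card_nbrs_Int_closed_nbrs:
  assumes "s \<noteq> v"
  shows "card (nbrs v \<inter> insert s (nbrs s)) \<le> 1"
proof -
  have "x = y" if "x \<in> nbrs v \<inter> insert s (nbrs s)" "y \<in> nbrs v \<inter> insert s (nbrs s)" for x y
    using that assms square_free[of v x y s] triangle_free[of v s x] triangle_free[of v s y]
    by auto
  then show ?thesis
    by (simp add: card_le_Suc0_iff_eq finite_nbrs)
qed

text \<open>If \<open>v\<close> carries a token, it is moved to a neighbour first, which is possible because the
  target \<open>J\<close> has no other neighbour in \<open>X\<close>.\<close>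

lemma jumps_into_nbrs:
  assumes X: "independent_set G X" "card X = k" "1 \<le> k"
    and J: "J \<subseteq> nbrs v" "card J = k" "\<And>x. x \<in> X - {v} \<Longrightarrow> J \<inter> insert x (nbrs x) = {}"
  shows "(jump G k)\<^sup>*\<^sup>* X J"
proof -
  have finX: "finite X"
    using X card.infinite by fastforce
  have finJ: "finite J"
    using J(1) finite_nbrs by (rule finite_subset)
  have ind: "independent_set G ((X - {v}) \<union> J)"
    using X(1) independent_set_mono[OF independent_nbrs J(1)] J(3) arcs_commute
    unfolding independent_set_def by blast
  show ?thesis
  proof (cases "v \<in> X")
    case False
    then show ?thesis
      using jumps_within_independent_set[of G X J k] ind finX finJ X J by simp
  next
    case True
    obtain w where w: "w \<in> J"
      using J(2) X(3) by fastforce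
    define X' where "X' = insert w (X - {v})"
    \<comment> \<open>\<open>w\<close> is adjacent to \<open>v\<close>, which carries a token. Once
      that token is on \<open>w\<close>, all that remains lies in the independent set
      \<open>(X - {v}) \<union> J\<close>.\<close>
    have "w \<notin> X"
      using w True J(1) X(1) by (auto simp: independent_set_def)
    have sub: "X' \<union> J = (X - {v}) \<union> J"
      using w by (auto simp: X'_def)
    have step: "jump G k X X'"
      unfolding X'_def using X ind sub finX True \<open>w \<notin> X\<close>
      by (intro jump_swap) (auto intro: independent_set_mono simp: X'_def)
    have "(jump G k)\<^sup>*\<^sup>* X' J"
      using step ind finX finJ J(2) sub by (intro jumps_within_independent_set) (auto simp: jump_def X'_def)
    with step show ?thesis
      by (rule converse_rtranclp_into_rtranclp)
  qed
qed

lemma jumps_if_many_vertices: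
  assumes S: "independent_set G S" "card S = k" and T: "independent_set G T" "card T = k"
    and "1 \<le> k" "9 * k ^ 2 \<le> card (pverts G)"
  shows "(jump G k)\<^sup>*\<^sup>* S T"
proof -
  have fin: "finite S" "finite T"
    using S T \<open>1 \<le> k\<close> card.infinite by fastforce+
  have cST: "card (S \<union> T) \<le> 2 * k"
    using card_Un_le[of S T] S T by simp
  obtain J where "(jump G k)\<^sup>*\<^sup>* S J" "(jump G k)\<^sup>*\<^sup>* T J"
  proof (cases "\<exists>v \<in> pverts G. 3 * k \<le> card (nbrs v)")
    case True
    then obtain v where v: "3 * k \<le> card (nbrs v)" by blast
    \<comment> \<open>\<open>N\<close> collects the neighbours of \<open>v\<close> blocked by tokens
      off \<open>v\<close>. Each of these at most \<open>2 * k\<close> tokens blocks at most one, so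
      \<open>k\<close> of the \<open>3 * k\<close> neighbours stay available.\<close>
    define N where "N = (\<Union>s \<in> S \<union> T - {v}. nbrs v \<inter> insert s (nbrs s))"
    have "card N \<le> (\<Sum>s \<in> S \<union> T - {v}. card (nbrs v \<inter> insert s (nbrs s)))"
      unfolding N_def by (rule card_UN_le) (use fin in simp)
    also have "\<dots> \<le> card (S \<union> T - {v})"
      using sum_bounded_above[of "S \<union> T - {v}" "\<lambda>s. card (nbrs v \<inter> insert s (nbrs s))" 1]
        card_nbrs_Int_closed_nbrs by simp
    also have "\<dots> \<le> card (S \<union> T)"
      using fin by (intro card_mono) auto
    finally have "card N \<le> 2 * k"
      using cST by simp
    moreover have "finite N"
      using fin finite_nbrs by (simp add: N_def)
    then have "card (nbrs v) - card N \<le> card (nbrs v - N)"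
      by (rule diff_card_le_card_Diff)
    ultimately have "k \<le> card (nbrs v - N)"
      using v by simp
    then obtain J where J: "J \<subseteq> nbrs v - N" "card J = k"
      by (meson obtain_subset_with_card_n)
    have "J \<inter> insert s (nbrs s) = {}" if "s \<in> S \<union> T - {v}" for s
      using J that by (auto simp: N_def)
    then show ?thesis
      using J S T \<open>1 \<le> k\<close> by (intro that[of J] jumps_into_nbrs[where v = v]) auto
  next
    case False
    then have deg: "\<And>v. v \<in> pverts G \<Longrightarrow> card (nbrs v) < 3 * k"
      by force
    define N where "N = (\<Union>s \<in> S \<union> T. insert s (nbrs s))"
    have ST: "S \<union> T \<subseteq> pverts G"
      using S T by (auto simp: independent_set_def)
    have "card N \<le> (\<Sum>s \<in> S \<union> T. card (insert s (nbrs s)))"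
      unfolding N_def by (rule card_UN_le) (use fin in simp)
    also have "\<dots> \<le> card (S \<union> T) * (3 * k)"
      using sum_bounded_above[of "S \<union> T" "\<lambda>s. card (insert s (nbrs s))" "3 * k"] deg ST
      by (auto simp: card_insert_if finite_nbrs no_arc_refl Suc_le_eq)
    also have "\<dots> \<le> 2 * k * (3 * k)"
      using cST by (rule mult_right_mono) simp
    finally have "card N \<le> 6 * k ^ 2"
      by (simp add: power2_eq_square)
    moreover have "finite N"
      using fin finite_nbrs by (simp add: N_def)
    then have "card (pverts G) - card N \<le> card (pverts G - N)"
      by (rule diff_card_le_card_Diff)
    \<comment> \<open>Of the \<open>9 * k ^ 2\<close> vertices at most \<open>6 * k ^ 2\<close> are
      lost to \<open>N\<close>; the remaining \<open>3 * k ^ 2\<close> are what the greedy choice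
      needs for degrees below \<open>3 * k\<close>.\<close>
    ultimately have "3 * k * k \<le> card (pverts G - N)"
      using assms(6) by (simp add: power2_eq_square)
    then obtain J where J: "J \<subseteq> pverts G - N" "independent_set G J" "card J = k"
      using greedy_independent_set[OF deg, of "pverts G - N" k] \<open>1 \<le> k\<close> by auto
    have finJ: "finite J"
      using J(1) pair_finite_verts by (meson Diff_subset finite_subset)
    have "independent_set G (X \<union> J)" if "X \<subseteq> S \<union> T" "independent_set G X" for X
      using J(1,2) that arcs_commute unfolding independent_set_def N_def by blast
    then show ?thesis
      using J S T fin finJ by (intro that[of J] jumps_within_independent_set) auto
  qed
  then show ?thesis
    \<comment> \<open>Jumps are reversible, so the sequence from \<open>T\<close> to
      \<open>J\<close> is followed backwards.\<close>
    by (meson jumps_commute rtranclp_trans)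
qed

end

section \<open>The kernelization machine\<close>

lemma word_contents_snoc:
  "i = int (length w) \<Longrightarrow> (word_contents w)(i := s) = word_contents (w @ [s])"
  by (auto simp: fun_eq_iff word_contents_def nth_append)

lemma word_contents_replicate_Suc:
  "(word_contents (replicate i s))(int i := s) = word_contents (replicate (Suc i) s)"
  by (subst word_contents_snoc) (auto simp: replicate_append_same)

lemma word_contents_take_Suc:
  "i < length w \<Longrightarrow>
    (word_contents (take i w))(int i := word_contents w (int i)) = word_contents (take (Suc i) w)"
  by (subst word_contents_snoc) (auto simp: take_Suc_conv_app_nth word_contents_def)

text \<open>This encodes one token on a graph with a single vertex and no arcs; see
  \<open>encode_yes_instance\<close>.\<close>

definition yes_word :: "nat list" where
  "yes_word = [2, 3, 2, 3, 2, 3, 1]"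

text \<open>The tapes are numbered from 0 to 3.  State 0 copies the number of tokens \<open>k\<close> to tapes 1
  and 2.  States 1 to 10 advance on the \<open>n\<close> cells of the source vector, nine cells per pass
  through the states 1 to 9, while heads 1 and 2 run through \<open>k\<^sup>2\<close> positions, from right to
  left; state 10 rewinds head 1.  If the vector is exhausted first, then \<open>n < 9 * k\<^sup>2\<close>, and
  states 19 and 20 copy the input to tape 3; otherwise states 11 to 17 write \<open>yes_word\<close>.
  State 18 is the halting state.\<close>

definition kernel_delta :: "nat \<Rightarrow> nat list \<Rightarrow> nat \<times> (nat \<times> head_move) list" where
  "kernel_delta q ss =
     (let a = ss ! 0; b = ss ! 1; c = ss ! 2; d = ss ! 3 in
      if q = 0 then
        (if a = 2 then (0, [(a, Move_Right), (2, Move_Right), (2, Move_Right), (d, Stay)])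
         else (1, [(a, Move_Right), (b, Move_Left), (c, Move_Left), (d, Stay)]))
      else if q \<le> 9 then
        (if b = 0 then (10, [(a, Stay), (b, Move_Right), (c, Move_Left), (d, Stay)])
         else if a = 3 then (19, [(a, Stay), (b, Stay), (c, Stay), (d, Stay)])
         else if q = 9 then (1, [(a, Move_Right), (b, Move_Left), (c, Stay), (d, Stay)])
         else (Suc q, [(a, Move_Right), (b, Stay), (c, Stay), (d, Stay)]))
      else if q = 10 then
        (if b \<noteq> 0 then (10, [(a, Stay), (b, Move_Right), (c, Stay), (d, Stay)])
         else if c = 0 then (11, [(a, Stay), (b, Stay), (c, Stay), (d, Stay)])
         else (1, [(a, Stay), (b, Move_Left), (c, Stay), (d, Stay)]))
      else if q \<le> 17 then
        (Suc q, [(a, Stay), (b, Stay), (c, Stay), (yes_word ! (q - 11), Move_Right)])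
      else if q = 19 then
        (if a = 0 then (20, [(a, Move_Right), (b, Stay), (c, Stay), (d, Stay)])
         else (19, [(a, Move_Left), (b, Stay), (c, Stay), (d, Stay)]))
      else if q = 20 then
        (if a = 0 then (18, [(a, Stay), (b, Stay), (c, Stay), (d, Stay)])
         else (20, [(a, Move_Right), (b, Stay), (c, Stay), (a, Move_Right)]))
      else (18, [(a, Stay), (b, Stay), (c, Stay), (d, Stay)]))"

definition kernel_machine :: turing_machine where
  "kernel_machine =
     \<lparr>tm_tapes = 4, tm_symbols = 4, tm_states = 21, tm_halt = 18, tm_delta = kernel_delta\<rparr>"

lemma is_turing_machine_kernel_machine: "is_turing_machine kernel_machine"
proof -
  have "fst (kernel_delta q ss) < 21 \<and> length (snd (kernel_delta q ss)) = 4 \<and>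
      fst ` set (snd (kernel_delta q ss)) \<subseteq> {..<4}"
    if q: "q < 21" and ss: "length ss = 4" "set ss \<subseteq> {..<4}" for q ss
  proof -
    obtain a b c d where [simp]: "ss = [a, b, c, d]"
      using ss(1) by (auto simp: numeral_eq_Suc length_Suc_conv)
    have [simp]: "a < 4" "b < 4" "c < 4" "d < 4"
      using ss(2) by auto
    have "yes_word ! i < 4" if "i < 7" for i
      using that by (auto simp: yes_word_def less_Suc_eq numeral_eq_Suc)
    then show ?thesis
      using q by (simp add: kernel_delta_def)
  qed
  then show ?thesis
    by (simp add: is_turing_machine_def kernel_machine_def case_prod_beta)
qed

section \<open>Running times, counted back from the halting state\<close>

lemma kernel_step:
  "tm_step kernel_machine (q, [(A, a), (B, b), (C, c), (D, d)]) =
     (if q = 18 then (q, [(A, a), (B, b), (C, c), (D, d)])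
      else case kernel_delta q [A a, B b, C c, D d] of
        (q', acts) \<Rightarrow> (q', map2 tape_act acts [(A, a), (B, b), (C, c), (D, d)]))"
  by (simp add: kernel_machine_def)

lemma kernel_step_halted: "tm_step kernel_machine (18, ts) = (18, ts)"
  by (simp add: kernel_machine_def)

declare tm_step.simps [simp del]

text \<open>\<open>fun_upd_idem\<close> disposes of the tapes on which the symbol just read is
  written back.\<close>

lemmas kernel_simps = kernel_step kernel_delta_def Let_def fun_upd_idem

text \<open>Bounds are built backwards: each step preceding a configuration adds one to
  \<open>t\<close>. Halting in fewer than \<open>t\<close> steps is allowed, so that bounds may be
  weakened.\<close>

definition outputs_from :: "nat list \<Rightarrow> nat \<Rightarrow> nat \<times> tape list \<Rightarrow> bool" where
  "outputs_from w t conf \<longleftrightarrow>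
     (\<exists>s\<le>t. \<exists>ts. (tm_step kernel_machine ^^ s) conf = (18, ts) \<and> fst (last ts) = word_contents w)"

lemma outputs_from_step:
  assumes "outputs_from w t (tm_step kernel_machine conf)"
  shows "outputs_from w (Suc t) conf"
proof -
  from assms obtain s ts where "s \<le> t"
      "(tm_step kernel_machine ^^ s) (tm_step kernel_machine conf) = (18, ts)"
      "fst (last ts) = word_contents w"
    by (auto simp: outputs_from_def)
  then show ?thesis
    by (auto simp: outputs_from_def funpow_Suc_right simp del: funpow.simps intro!: exI[of _ "Suc s"])
qed

lemma outputs_from_halt: "fst (last ts) = word_contents w \<Longrightarrow> outputs_from w t (18, ts)"
  by (auto simp: outputs_from_def intro: exI[of _ 0])

lemma outputs_from_mono: "outputs_from w t conf \<Longrightarrow> t \<le> t' \<Longrightarrow> outputs_from w t' conf"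
  unfolding outputs_from_def by (meson le_trans)

text \<open>A halted machine no longer changes its configuration, so an early halt still shows after
  exactly \<open>t\<close> steps.\<close>

lemma tm_outputs_within_if_outputs_from:
  assumes "outputs_from w' t (tm_init kernel_machine w)"
  shows "tm_outputs_within kernel_machine t w w'"
proof -
  let ?step = "tm_step kernel_machine"
  from assms obtain s ts where s: "s \<le> t" "(?step ^^ s) (tm_init kernel_machine w) = (18, ts)"
      "fst (last ts) = word_contents w'"
    by (auto simp: outputs_from_def)
  have halted: "(?step ^^ i) (18, ts) = (18, ts)" for i
    by (induction i) (auto simp: kernel_step_halted)
  have "(?step ^^ t) (tm_init kernel_machine w) =
      (?step ^^ (t - s)) ((?step ^^ s) (tm_init kernel_machine w))"
    using s(1) by (metis comp_apply funpow_add le_add_diff_inverse2)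
  then show ?thesis
    using s halted by (simp add: tm_outputs_within_def kernel_machine_def)
qed

lemma outputs_yes_word:
  "outputs_from yes_word 7 (11, [(A, a), (B, b), (C, c), (word_contents [], 0)])"
proof -
  \<comment> \<open>The state counts the symbols written so far; after all seven it is
    \<open>11 + 7 = 18\<close>, the halting state.\<close>
  have "outputs_from yes_word (7 - i)
      (11 + i, [(A, a), (B, b), (C, c), (word_contents (take i yes_word), int i)])" if "i \<le> 7" for i
    using that
  proof (induction i rule: inc_induct)
    case base
    show ?case by (simp add: outputs_from_halt yes_word_def)
  next
    case (step i)
    have i: "i < length yes_word"
      using step.hyps by (simp add: yes_word_def)
    then have "(word_contents (take i yes_word))(int i := yes_word ! i) =
        word_contents (take (Suc i) yes_word)"
      by (subst word_contents_take_Suc[symmetric]) (auto simp: word_contents_def)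
    moreover have "7 - i = Suc (7 - Suc i)"
      using step.hyps by simp
    ultimately show ?case
      using step.IH step.hyps by (auto simp: kernel_simps add.commute intro!: outputs_from_step)
  qed
  from this[of 0] show ?thesis by simp
qed

text \<open>As 0 does not occur in \<open>w\<close>, the first blank read marks its end. The
  additional step is the transition to the halting state.\<close>

lemma outputs_copy:
  assumes "0 \<notin> set w" "i \<le> length w"
  shows "outputs_from w (Suc (length w - i))
    (20, [(word_contents w, int i), (B, b), (C, c), (word_contents (take i w), int i)])"
  using assms(2)
proof (induction i rule: inc_induct)
  case base
  have "word_contents w (int (length w)) = 0"
    by (simp add: word_contents_def)
  then show ?case
    by (auto simp: kernel_simps intro!: outputs_from_step outputs_from_halt)
next
  case (step i)
  have "word_contents w (int i) \<noteq> 0"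
    using step.hyps assms(1) by (auto simp: word_contents_def in_set_conv_nth)
  then have "outputs_from w (Suc (length w - Suc i)) (tm_step kernel_machine
      (20, [(word_contents w, int i), (B, b), (C, c), (word_contents (take i w), int i)]))"
    using step.IH step.hyps word_contents_take_Suc[of i w]
    by (simp add: kernel_simps add.commute)
  then have "outputs_from w (Suc (Suc (length w - Suc i)))
      (20, [(word_contents w, int i), (B, b), (C, c), (word_contents (take i w), int i)])"
    by (rule outputs_from_step)
  then show ?case
    using step.hyps by (simp add: Suc_diff_Suc)
qed

text \<open>With head 0 at \<open>int i - 1\<close>, the case \<open>i = 0\<close> is the blank cell
  left of the input, where rewinding stops.\<close>

lemma outputs_rewind_copy:
  assumes "0 \<notin> set w" "i \<le> length w"
  shows "outputs_from w (length w + i + 2)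
    (19, [(word_contents w, int i - 1), (B, b), (C, c), (word_contents [], 0)])"
  using assms(2)
proof (induction i)
  case 0
  have "word_contents w (- 1) = 0"
    by (simp add: word_contents_def)
  then have "outputs_from w (Suc (Suc (length w)))
      (19, [(word_contents w, - 1), (B, b), (C, c), (word_contents [], 0)])"
    using outputs_copy[OF assms(1), of 0]
    by - (rule outputs_from_step, simp add: kernel_simps)
  then show ?case by simp
next
  case (Suc i)
  have "word_contents w (int i) \<noteq> 0"
    using Suc.prems assms(1) by (auto simp: word_contents_def in_set_conv_nth)
  then have "outputs_from w (length w + i + 2) (tm_step kernel_machine
      (19, [(word_contents w, int i), (B, b), (C, c), (word_contents [], 0)]))"
    using Suc by (simp add: kernel_simps)
  then have "outputs_from w (Suc (length w + i + 2))
      (19, [(word_contents w, int i), (B, b), (C, c), (word_contents [], 0)])"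
    by (rule outputs_from_step)
  then show ?case by simp
qed

section \<open>The machine on an encoded instance\<close>

locale kernel_input =
  fixes k :: nat and s r :: "nat list"
  assumes tokens: "1 \<le> k" and s: "set s \<subseteq> {1, 2}" and r: "0 \<notin> set r"
begin

text \<open>\<open>s\<close> is the source vector, whose end is recognised by the symbol 3;
  \<open>r\<close> is all that follows the second separator and is at most copied.\<close>

definition w :: "nat list" where
  "w = replicate k 2 @ 3 # s @ 3 # r"

definition out :: "nat list" where
  "out = (if 9 * k ^ 2 \<le> length s then yes_word else w)"

abbreviation unary :: "int \<Rightarrow> nat" where
  "unary \<equiv> word_contents (replicate k 2)"

text \<open>The offset \<open>Suc k\<close> skips the tokens and their separator: head 0 is on entry
  \<open>t\<close> of \<open>s\<close>, or on the separator behind \<open>s\<close> if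
  \<open>t = length s\<close>.\<close>

abbreviation conf :: "nat \<Rightarrow> nat \<Rightarrow> int \<Rightarrow> int \<Rightarrow> nat \<times> tape list" where
  "conf q t b c \<equiv>
     (q, [(word_contents w, int (Suc k + t)), (unary, b), (unary, c), (word_contents [], 0)])"

lemma length_w: "length w = k + length s + length r + 2"
  by (simp add: w_def)

lemma zero_notin_w: "0 \<notin> set w"
  using s r by (auto simp: w_def)

lemma word_contents_w:
  "i < k \<Longrightarrow> word_contents w (int i) = 2"
  "word_contents w (int k) = 3"
  "t < length s \<Longrightarrow> word_contents w (int (Suc k + t)) \<noteq> 3"
  "word_contents w (int (Suc k + length s)) = 3"
proof -
  show "t < length s \<Longrightarrow> word_contents w (int (Suc k + t)) \<noteq> 3"
    using s nth_mem[of t s] by (fastforce simp: word_contents_def w_def nth_append simp del: of_nat_add of_nat_Suc)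
qed (auto simp: word_contents_def w_def nth_append simp del: of_nat_add of_nat_Suc)

lemma unary_simps [simp]: "i < k \<Longrightarrow> unary (int i) = 2" "unary (int k) = 0" "unary (-1) = 0"
  by (auto simp: word_contents_def)

lemma outputs_small:
  assumes "t \<le> length s" "length s < 9 * k ^ 2"
  shows "outputs_from out (2 * length w + 2) (conf 19 t b c)"
proof -
  \<comment> \<open>The position is put into the form \<open>int i - 1\<close> of
    \<open>outputs_rewind_copy\<close>; \<open>i \<le> length w\<close> holds as \<open>w\<close>
    has two separators besides the tokens and \<open>s\<close>.\<close>
  have "int (Suc k + t) = int (Suc (Suc k + t)) - 1" by simp
  moreover have "outputs_from w (length w + Suc (Suc k + t) + 2) (19, [(word_contents w,
      int (Suc (Suc k + t)) - 1), (unary, b), (unary, c), (word_contents [], 0)])"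
    using assms by (intro outputs_rewind_copy zero_notin_w) (auto simp: length_w)
  ultimately show ?thesis
    using assms by (auto simp: out_def length_w elim: outputs_from_mono)
qed

text \<open>In state \<open>10 - m\<close> the current pass has \<open>m\<close> cells left.
  \<open>T\<close> pays for what follows, be it the next pass or, when \<open>s\<close> ends first,
  the copying of the input.\<close>

lemma outputs_advance:
  assumes "1 \<le> m" "m \<le> 9" "b < k" "t \<le> length s"
    and "t + m \<le> length s \<Longrightarrow> outputs_from out T (conf 1 (t + m) (int b - 1) c)"
    and "length s < t + m \<Longrightarrow> length s < 9 * k ^ 2" "2 * length w + 2 \<le> T"
  shows "outputs_from out (T + m) (conf (10 - m) t (int b) c)"
  using assms
proof (induction m arbitrary: t)
  case (Suc m)
  have q: "10 - Suc m \<noteq> 0" "10 - Suc m \<le> 9" "10 - Suc m \<noteq> 18"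
    using Suc.prems by auto
  show ?case
  proof (cases "t = length s")
    case True
    then have "word_contents w (int (Suc k + t)) = 3" "length s < 9 * k ^ 2"
      using word_contents_w Suc.prems by auto
    then have "outputs_from out (2 * length w + 2)
        (tm_step kernel_machine (conf (10 - Suc m) t (int b) c))"
      using q outputs_small[OF Suc.prems(4)] Suc.prems(3)
      by (simp add: kernel_simps del: of_nat_Suc of_nat_add)
    then have "outputs_from out (Suc (2 * length w + 2)) (conf (10 - Suc m) t (int b) c)"
      by (rule outputs_from_step)
    then show ?thesis
      by (rule outputs_from_mono) (use Suc.prems in simp)
  next
    case False
    then have t: "t < length s"
      using Suc.prems by simp
    have "outputs_from out (T + m) (tm_step kernel_machine (conf (10 - Suc m) t (int b) c))"
    proof (cases "m = 0")
      case True
      then show ?thesis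
        using word_contents_w(3)[OF t] Suc.prems t
        by (simp add: kernel_simps add.commute)
    next
      case False
      then have "outputs_from out (T + m) (conf (10 - m) (Suc t) (int b) c)"
        using Suc.prems t by (intro Suc.IH) auto
      moreover have "Suc (10 - Suc m) = 10 - m" "10 - Suc m \<noteq> 9"
        using False Suc.prems(2) by auto
      ultimately show ?thesis
        using word_contents_w(3)[OF t] Suc.prems(3) q
        by (simp add: kernel_simps add.commute)
    qed
    then show ?thesis
      by (auto dest: outputs_from_step)
  qed
qed simp

lemma outputs_rewind_unary:
  assumes "b \<le> k" "outputs_from out T (conf 10 t (int k) c)"
  shows "outputs_from out (T + (k - b)) (conf 10 t (int b) c)"
  using assms(1)
proof (induction b rule: inc_induct)
  case base
  show ?case using assms(2) by simp
next
  case (step b)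
  then have "outputs_from out (T + (k - Suc b)) (tm_step kernel_machine (conf 10 t (int b) c))"
    by (simp add: kernel_simps add.commute)
  then have "outputs_from out (Suc (T + (k - Suc b))) (conf 10 t (int b) c)"
    by (rule outputs_from_step)
  then show ?case
    using step.hyps by (simp add: Suc_diff_Suc)
qed

text \<open>In a loop configuration, \<open>c\<close> further rounds follow the current one, in which \<open>b\<close> passes
  are left.\<close>

lemma outputs_loop:
  assumes "t + 9 * (c * k + b) = 9 * k ^ 2" "t \<le> length s" "b \<le> k" "c < k"
  shows "outputs_from out (c * (10 * k + 3) + 9 * b + k + 2 * length w + 12)
    (conf 1 t (int b - 1) (int c))"
  using assms
proof (induction c arbitrary: t b)
  case 0
  from 0 show ?case
  proof (induction b arbitrary: t)
    case 0
    \<comment> \<open>With no rounds and passes left the invariant reads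
      \<open>t = 9 * k ^ 2\<close>, hence \<open>s\<close> is long enough.\<close>
    then have out: "out = yes_word"
      by (simp add: out_def)
    \<comment> \<open>Head 2 has left the unary block; the blank at cell -1 makes state 10 proceed
      to writing \<open>yes_word\<close>.\<close>
    have "outputs_from out 7 (conf 11 t (int k) (- 1))"
      using outputs_yes_word by (simp add: out)
    then have "outputs_from out 8 (conf 10 t (int k) (- 1))"
      using outputs_from_step[of out 7 "conf 10 t (int k) (- 1)"] by (simp add: kernel_simps)
    then have "outputs_from out (8 + (k - 0)) (conf 10 t (int 0) (- 1))"
      by (intro outputs_rewind_unary) auto
    then have "outputs_from out (Suc (8 + k)) (conf 1 t (- 1) 0)"
      by (intro outputs_from_step) (simp add: kernel_simps)
    then show ?case
      by (auto elim: outputs_from_mono)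
  next
    case (Suc b)
    \<comment> \<open>One full pass, \<open>m = 9\<close>. If \<open>s\<close> ends within it, the
      invariant with at least one pass left gives \<open>length s < 9 * k ^ 2\<close>.\<close>
    have "outputs_from out (9 * b + k + 2 * length w + 12 + 9) (conf (10 - 9) t (int b) (int 0))"
      using Suc.prems Suc.IH[of "t + 9"] by (intro outputs_advance) auto
    then show ?case by (simp add: algebra_simps)
  qed
next
  case (Suc c)
  note IHc = Suc.IH
  from Suc.prems show ?case
  proof (induction b arbitrary: t)
    case 0
    \<comment> \<open>The next round starts with \<open>k\<close> passes. The summand
      \<open>10 * k + 3\<close> pays for a whole round: nine steps per pass, \<open>k\<close> steps
      of rewinding, and the transitions into and out of state 10.\<close>
    let ?T = "c * (10 * k + 3) + 9 * k + k + 2 * length w + 12"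
    have "outputs_from out ?T (conf 1 t (int k - 1) (int c))"
      using 0 by (intro IHc) (auto simp: algebra_simps)
    then have "outputs_from out (Suc ?T) (conf 10 t (int k) (int c))"
      using 0 by (intro outputs_from_step) (simp add: kernel_simps)
    then have "outputs_from out (Suc ?T + (k - 0)) (conf 10 t (int 0) (int c))"
      by (intro outputs_rewind_unary) auto
    then have "outputs_from out (Suc (Suc ?T + k)) (conf 1 t (- 1) (int (Suc c)))"
      by (intro outputs_from_step) (simp add: kernel_simps)
    then show ?case
      by (auto simp: algebra_simps elim: outputs_from_mono)
  next
    case (Suc b)
    have "outputs_from out (Suc c * (10 * k + 3) + 9 * b + k + 2 * length w + 12 + 9)
        (conf (10 - 9) t (int b) (int (Suc c)))"
      using Suc.prems Suc.IH[of "t + 9"] by (intro outputs_advance) auto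
    then show ?case by (simp add: algebra_simps)
  qed
qed

text \<open>The separator behind the tokens ends state 0; the move to the left then puts heads 1 and
  2 on the last symbol of their unary blocks.\<close>

lemma outputs_copy_tokens:
  assumes "i \<le> k" "outputs_from out T (conf 1 0 (int k - 1) (int k - 1))"
  shows "outputs_from out (Suc T + (k - i)) (0, [(word_contents w, int i),
    (word_contents (replicate i 2), int i), (word_contents (replicate i 2), int i), (word_contents [], 0)])"
  using assms(1)
proof (induction i rule: inc_induct)
  case base
  show ?case
    using assms(2) word_contents_w(2)
    by (auto simp: kernel_simps add.commute intro!: outputs_from_step)
next
  case (step i)
  let ?conf = "(0, [(word_contents w, int i), (word_contents (replicate i 2), int i),
    (word_contents (replicate i 2), int i), (word_contents [], 0)])"
  have "outputs_from out (Suc T + (k - Suc i)) (tm_step kernel_machine ?conf)"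
    using step.IH word_contents_w(1)[of i] step.hyps word_contents_replicate_Suc[of i 2]
    by (simp add: kernel_simps add.commute)
  then have "outputs_from out (Suc (Suc T + (k - Suc i))) ?conf"
    by (rule outputs_from_step)
  then show ?case
    using step.hyps by (simp add: Suc_diff_Suc)
qed

lemma tm_outputs_within_kernel_machine:
  "tm_outputs_within kernel_machine (poly [:30, 30, 30:] (length w)) w out"
proof (rule tm_outputs_within_if_outputs_from)
  let ?T = "(k - 1) * (10 * k + 3) + 9 * k + k + 2 * length w + 12"
  have k: "k \<le> length w"
    by (simp add: length_w)
  \<comment> \<open>The first round has \<open>k\<close> passes and \<open>k - 1\<close> rounds
    follow it, which makes \<open>k ^ 2\<close> passes of nine cells.\<close>
  have "9 * ((k - 1) * k + k) = 9 * k ^ 2"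
    using tokens by (simp add: power2_eq_square algebra_simps)
  then have "outputs_from out ?T (conf 1 0 (int k - 1) (int (k - 1)))"
    using tokens by (intro outputs_loop) auto
  then have "outputs_from out (Suc ?T + (k - 0)) (tm_init kernel_machine w)"
    using outputs_copy_tokens[of 0 ?T] tokens
    by (simp add: tm_init_def kernel_machine_def numeral_eq_Suc of_nat_diff)
  then show "outputs_from out (poly [:30, 30, 30:] (length w)) (tm_init kernel_machine w)"
  proof (rule outputs_from_mono)
    have "(k - 1) * (10 * k + 3) \<le> length w * (10 * length w + 3)"
      using k by (intro mult_mono) auto
    then show "Suc ?T + (k - 0) \<le> poly [:30, 30, 30:] (length w)"
      using k by (simp add: algebra_simps)
  qed
qed

end

section \<open>The kernel\<close>

lemma induced_free_if_card_less:
  assumes "finite (pverts G)" "card (pverts G) < card (pverts H)"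
  shows "induced_free H G"
  unfolding induced_free_def
proof
  assume "\<exists>I. induced_subgraph I (with_proj G) \<and> digraph_iso I (with_proj H)"
  then obtain I f where I: "induced_subgraph I (with_proj G)" and f: "with_proj H = app_iso f I"
    unfolding digraph_iso_def by blast
  have sub: "verts I \<subseteq> pverts G"
    using I by (simp add: induced_subgraph_def subgraph_def)
  have "pverts H = iso_verts f ` verts I"
    using verts_app_iso[of f I] with_proj_simps(1)[of H] unfolding f by simp
  moreover have "finite (verts I)"
    using sub assms(1) by (rule finite_subset)
  ultimately have "card (pverts H) \<le> card (pverts G)"
    using sub assms(1) by (metis card_image_le card_mono le_trans)
  with assms(2) show False by simp
qed

definition single_vertex :: "nat pair_pre_digraph" where
  "single_vertex = \<lparr>pverts = {0}, parcs = {}\<rparr>"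

definition yes_instance :: tj_instance where
  "yes_instance = \<lparr>tj_graph = single_vertex, tj_source = {0}, tj_target = {0}, tj_tokens = 1\<rparr>"

lemma pair_graph_single_vertex: "pair_graph single_vertex"
  by unfold_locales (auto simp: single_vertex_def symmetric_def sym_def)

lemma induced_free_single_vertex:
  assumes "2 \<le> p"
  shows "induced_free (cycle_graph p) single_vertex"
  using assms by (intro induced_free_if_card_less) (auto simp: single_vertex_def cycle_graph_def)

lemma bipartite_single_vertex: "bipartite single_vertex"
  unfolding bipartite_def single_vertex_def by (auto intro: exI[of _ "{0}"] exI[of _ "{}"])

lemma num_verts_yes_instance: "num_verts yes_instance = 1"
  by (simp add: num_verts_def yes_instance_def single_vertex_def)

lemma valid_yes_instance: "valid_tj_instance yes_instance"
  using pair_graph_single_vertex num_verts_yes_instance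
  by (auto simp: valid_tj_instance_def yes_instance_def single_vertex_def independent_set_def)

lemma tj_yes_yes_instance: "tj_yes yes_instance"
  using valid_yes_instance by (rule tj_yesI) (simp add: yes_instance_def)

lemma encode_yes_instance: "encode_tj yes_instance = yes_word"
  by (simp add: encode_tj_def num_verts_yes_instance)
    (simp add: yes_instance_def single_vertex_def bit_symbol_def yes_word_def)

text \<open>The one-vertex graph has to be in the class because a large input is replaced by
  \<open>yes_instance\<close>, and outputs must stay in the class.\<close>

lemma tj_kernel_girth5:
  assumes girth5: "\<And>G. pair_graph G \<Longrightarrow> \<C> G \<Longrightarrow> girth5_graph G"
    and single_vertex: "\<C> single_vertex"
  shows "tj_kernel \<C> (\<lambda>k. 9 * k ^ 2)"
  unfolding tj_kernel_def
proof (rule exI[of _ kernel_machine], rule exI[of _ "[:30, 30, 30:]"], intro conjI allI impI)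
  show "is_turing_machine kernel_machine"
    by (rule is_turing_machine_kernel_machine)
  fix x
  assume x: "valid_tj_instance x \<and> \<C> (tj_graph x)"
  let ?G = "tj_graph x" and ?k = "tj_tokens x" and ?n = "num_verts x"
  define s where "s = map (\<lambda>v. bit_symbol (v \<in> tj_source x)) [0..<?n]"
  define r where "r = map (\<lambda>v. bit_symbol (v \<in> tj_target x)) [0..<?n] @ 3 #
    concat (map (\<lambda>u. map (\<lambda>v. bit_symbol ((u, v) \<in> parcs ?G)) [0..<?n]) [0..<?n])"
  have k: "1 \<le> ?k"
    using x by (simp add: valid_tj_instance_def)
  interpret kernel_input ?k s r
    by unfold_locales (use k in \<open>auto simp: s_def r_def bit_symbol_def\<close>)
  have w: "encode_tj x = w"
    unfolding w_def by (simp add: encode_tj_def Let_def s_def r_def)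
  have len: "length s = ?n"
    by (simp add: s_def)
  define y where "y = (if 9 * ?k ^ 2 \<le> ?n then yes_instance else x)"
  have out: "encode_tj y = out"
    by (simp add: y_def out_def len w encode_yes_instance)
  have "tj_yes x \<longleftrightarrow> tj_yes y"
  proof (cases "9 * ?k ^ 2 \<le> ?n")
    case True
    interpret girth5_graph ?G
      using x girth5 by (simp add: valid_tj_instance_def)
    have "tj_yes x"
      using x True
      by (intro tj_yesI jumps_if_many_vertices) (auto simp: valid_tj_instance_def num_verts_def)
    then show ?thesis
      by (simp add: y_def True tj_yes_yes_instance)
  qed (simp add: y_def)
  moreover have "valid_tj_instance y" "\<C> (tj_graph y)"
    using x valid_yes_instance single_vertex by (auto simp: y_def yes_instance_def)
  \<comment> \<open>A replaced instance has one vertex, which is within the bound as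
    \<open>1 \<le> k\<close>; an instance that is kept lies below the threshold.\<close>
  moreover have "num_verts y \<le> 9 * ?k ^ 2"
    using k by (auto simp: y_def num_verts_yes_instance Suc_le_eq)
  moreover have "tm_outputs_within kernel_machine
      (poly [:30, 30, 30:] (length (encode_tj x))) (encode_tj x) (encode_tj y)"
    using tm_outputs_within_kernel_machine by (simp only: w out)
  ultimately show "\<exists>y. valid_tj_instance y \<and> \<C> (tj_graph y) \<and>
      tm_outputs_within kernel_machine
        (poly [:30, 30, 30:] (length (encode_tj x))) (encode_tj x) (encode_tj y) \<and>
      (tj_yes x \<longleftrightarrow> tj_yes y) \<and> num_verts y \<le> 9 * ?k ^ 2"
    by blast
qed

theorem theorem4:
  shows "(\<exists>f :: nat \<Rightarrow> nat. (\<lambda>k. real (f k)) \<in> O(\<lambda>k. real k ^ 2) \<and>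
            tj_kernel (\<lambda>G. induced_free (cycle_graph 3) G \<and> induced_free (cycle_graph 4) G) f) \<and>
         (\<exists>f :: nat \<Rightarrow> nat. (\<lambda>k. real (f k)) \<in> O(\<lambda>k. real k ^ 2) \<and>
            tj_kernel (\<lambda>G. bipartite G \<and> induced_free (cycle_graph 4) G) f)"
proof -
  have "(\<lambda>k. real (9 * k ^ 2)) \<in> O(\<lambda>k. real k ^ 2)"
    by simp
  moreover have "tj_kernel (\<lambda>G. induced_free (cycle_graph 3) G \<and> induced_free (cycle_graph 4) G)
      (\<lambda>k. 9 * k ^ 2)"
    by (intro tj_kernel_girth5) (auto simp: girth5_graphI induced_free_single_vertex)
  moreover have "tj_kernel (\<lambda>G. bipartite G \<and> induced_free (cycle_graph 4) G) (\<lambda>k. 9 * k ^ 2)"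
    by (intro tj_kernel_girth5)
      (auto simp: girth5_graphI induced_free_single_vertex bipartite_single_vertex)
  ultimately show ?thesis
    by (intro conjI exI[of _ "\<lambda>k. 9 * k ^ 2"])
qed

end
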